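(* Let $K$ be a field and let $C$ be a cycle (viewed as a simple graph, of length $n\ge3$). Then $C$ is rigid if and only if $C$ is a $4$-cycle or a $6$-cycle.
   Context: For a finite simple graph $G$ on $[n]$ let $S=K[x_1,\ldots,x_n]$; the edge ideal $I(G)\subseteq S$ is generated by the products $x_ix_j$ with $\{i,j\}\in E(G)$. For an ideal $I\subseteq S$, $T^1(S/I)$ is the cokernel of $\delta^*:\mathrm{Der}_K(S)\to\mathrm{Hom}_S(I,S/I)$, $\delta^*(\partial)(f)=\partial f+I$. The graph $G$ is called rigid if $T^1(S/I(G))=0$. *)

theory Defs
  imports "HOL-Algebra.QuotRing" "HOL-Algebra.Module" "HOL-Library.Poly_Mapping"
begin

section \<open>Modules over a commutative ring\<close>

text \<open>The library's module record extends the ring record.  For modules carrying no ring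
  structure the fields \<^const>\<open>mult\<close> and \<^const>\<open>one\<close> are left \<^const>\<open>undefined\<close>;
  the locale \<^locale>\<open>module\<close> never mentions them.\<close>

definition ideal_module :: "'a ring \<Rightarrow> 'a set \<Rightarrow> ('a, 'a) module" where
  "ideal_module R I = (ring.extend R (module.fields (mult R)))\<lparr>carrier := I\<rparr>"

definition quot_ring_module :: "'a ring \<Rightarrow> 'a set \<Rightarrow> ('a, 'a set) module" where
  "quot_ring_module R I =
     ring.extend (R Quot I) (module.fields (\<lambda>r X. (I +>\<^bsub>R\<^esub> r) \<otimes>\<^bsub>R Quot I\<^esub> X))"

text \<open>Maps defined only on a carrier are taken extensional, so that equality of maps is equality
  on the carrier.\<close>

definition Hom_module ::
  "'a ring \<Rightarrow> ('a, 'b) module \<Rightarrow> ('a, 'c) module \<Rightarrow> ('a, 'b \<Rightarrow> 'c) module" where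
  "Hom_module R M N =
     \<lparr>carrier = {h \<in> carrier M \<rightarrow>\<^sub>E carrier N.
                  (\<forall>x\<in>carrier M. \<forall>y\<in>carrier M. h (x \<oplus>\<^bsub>M\<^esub> y) = h x \<oplus>\<^bsub>N\<^esub> h y) \<and>
                  (\<forall>r\<in>carrier R. \<forall>x\<in>carrier M. h (r \<odot>\<^bsub>M\<^esub> x) = r \<odot>\<^bsub>N\<^esub> h x)},
      mult = undefined, one = undefined,
      zero = (\<lambda>x\<in>carrier M. \<zero>\<^bsub>N\<^esub>),
      add = (\<lambda>g h. \<lambda>x\<in>carrier M. g x \<oplus>\<^bsub>N\<^esub> h x),
      smult = (\<lambda>r h. \<lambda>x\<in>carrier M. r \<odot>\<^bsub>N\<^esub> h x)\<rparr>"

definition quotient_module :: "('a, 'b) module \<Rightarrow> 'b set \<Rightarrow> ('a, 'b set) module" where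
  "quotient_module M N =
     \<lparr>carrier = a_rcosets\<^bsub>M\<^esub> N, mult = undefined, one = undefined,
      zero = N, add = set_add M,
      smult = (\<lambda>r X. \<Union>x\<in>X. N +>\<^bsub>M\<^esub> (r \<odot>\<^bsub>M\<^esub> x))\<rparr>"

section \<open>Derivations and the first cotangent cohomology module\<close>

text \<open>Here \<open>K\<close> is the subset of scalars of the \<open>K\<close>-algebra \<open>S\<close>.\<close>

definition derivations :: "'a set \<Rightarrow> 'a ring \<Rightarrow> ('a \<Rightarrow> 'a) set" where
  "derivations K S =
     {d \<in> carrier S \<rightarrow>\<^sub>E carrier S.
        (\<forall>f\<in>carrier S. \<forall>g\<in>carrier S. d (f \<oplus>\<^bsub>S\<^esub> g) = d f \<oplus>\<^bsub>S\<^esub> d g) \<and>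
        (\<forall>c\<in>K. \<forall>f\<in>carrier S. d (c \<otimes>\<^bsub>S\<^esub> f) = c \<otimes>\<^bsub>S\<^esub> d f) \<and>
        (\<forall>f\<in>carrier S. \<forall>g\<in>carrier S.
           d (f \<otimes>\<^bsub>S\<^esub> g) = (f \<otimes>\<^bsub>S\<^esub> d g) \<oplus>\<^bsub>S\<^esub> (g \<otimes>\<^bsub>S\<^esub> d f))}"

definition delta_star :: "'a ring \<Rightarrow> 'a set \<Rightarrow> ('a \<Rightarrow> 'a) \<Rightarrow> ('a \<Rightarrow> 'a set)" where
  "delta_star S I d = (\<lambda>f\<in>I. I +>\<^bsub>S\<^esub> d f)"

text \<open>\<open>T1 K S I\<close> is the \<open>S\<close>-module $T^1(S/I)$, the cokernel of
  $\delta^* : Der_K(S) \to Hom_S(I, S/I)$.\<close>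

definition T1 :: "'a set \<Rightarrow> 'a ring \<Rightarrow> 'a set \<Rightarrow> ('a, ('a \<Rightarrow> 'a set) set) module" where
  "T1 K S I =
     quotient_module (Hom_module S (ideal_module S I) (quot_ring_module S I))
       (delta_star S I ` derivations K S)"

section \<open>Polynomial rings and edge ideals\<close>

text \<open>Exponent vectors are finitely supported functions \<open>nat \<Rightarrow>\<^sub>0 nat\<close>, and polynomials are
  finitely supported families of coefficients indexed by them.  The ring $K[x_1,\ldots,x_n]$
  consists of the polynomials in which only the variables $x_1,\ldots,x_n$ occur.\<close>

type_synonym 'k mpoly = "(nat \<Rightarrow>\<^sub>0 nat) \<Rightarrow>\<^sub>0 'k"

definition poly_var :: "nat \<Rightarrow> 'k::field mpoly" where
  "poly_var i = Poly_Mapping.single (Poly_Mapping.single i 1) 1"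

definition poly_consts :: "'k::field mpoly set" where
  "poly_consts = {Poly_Mapping.single 0 c | c. True}"

definition poly_ring :: "nat \<Rightarrow> 'k::field mpoly ring" where
  "poly_ring n =
     \<lparr>carrier = {p. \<forall>m\<in>Poly_Mapping.keys p. Poly_Mapping.keys m \<subseteq> {1..n}},
      mult = (*), one = 1, zero = 0, add = (+)\<rparr>"

text \<open>A graph on the vertex set \<open>{1..n}\<close> is given by \<open>n\<close> and its set of edges.\<close>

definition simple_graph :: "nat \<Rightarrow> nat set set \<Rightarrow> bool" where
  "simple_graph n E \<longleftrightarrow> (\<forall>e\<in>E. e \<subseteq> {1..n} \<and> card e = 2)"

definition edge_ideal :: "nat \<Rightarrow> nat set set \<Rightarrow> 'k::field mpoly set" where
  "edge_ideal n E =
     genideal (poly_ring n)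
       {poly_var i \<otimes>\<^bsub>poly_ring n\<^esub> poly_var j | i j. {i, j} \<in> E}"

definition rigid :: "'k::field itself \<Rightarrow> nat \<Rightarrow> nat set set \<Rightarrow> bool" where
  "rigid _ n E \<longleftrightarrow>
     (let T = T1 (poly_consts :: 'k mpoly set) (poly_ring n) (edge_ideal n E)
      in carrier T = {\<zero>\<^bsub>T\<^esub>})"

text \<open>The vertices \<open>v 0, \<dots>, v (n - 1)\<close> list \<open>{1..n}\<close> in cyclic order, so the cycle may be
  labelled arbitrarily and its length is \<open>n\<close>.\<close>

definition cycle_graph :: "nat \<Rightarrow> nat set set \<Rightarrow> bool" where
  "cycle_graph n E \<longleftrightarrow> simple_graph n E \<and> 3 \<le> n \<and>
     (\<exists>v. bij_betw v {..<n} {1..n} \<and> E = {{v i, v (Suc i mod n)} | i. i < n})"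

end

theory Submission
  imports Defs
begin

text \<open>
  Modulo \<open>I = I(G)\<close> a polynomial is determined by its coefficients at monomials with independent
  support.  A homomorphism \<open>I \<rightarrow> S/I\<close> with values \<open>p\<^sub>i\<^sub>j\<close> on the generators \<open>x\<^sub>i * x\<^sub>j\<close> comes from a
  derivation iff there are \<open>g\<^sub>i\<close> with \<open>p\<^sub>i\<^sub>j = x\<^sub>i * g\<^sub>j + x\<^sub>j * g\<^sub>i\<close> modulo \<open>I\<close>.  If \<open>G\<close> is triangle-free, comparing
  coefficients in \<open>x\<^sub>k * p\<^sub>i\<^sub>j = x\<^sub>j * p\<^sub>i\<^sub>k\<close> shows that the only obstructions are pairs of an edge
  \<open>ij\<close> and an independent set \<open>F\<close> avoiding it such that every other neighbour of \<open>i\<close> or \<open>j\<close> is adjacent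
  to \<open>F\<close>; they give the homomorphisms sending \<open>x\<^sub>i * x\<^sub>j\<close> to \<open>x\<^sup>F\<close> and all other generators to \<open>0\<close>.
  In a cycle such an \<open>F\<close> must contain the vertices two steps beyond the edge on both sides; these
  are equal for \<open>n = 5\<close>, adjacent for \<open>n = 4\<close> and \<open>n = 6\<close>, and otherwise independent.
  For the triangle, \<open>x\<^sub>1 * x\<^sub>2 \<mapsto> x\<^sub>1\<close>, \<open>x\<^sub>1 * x\<^sub>3 \<mapsto> 0\<close>, \<open>x\<^sub>2 * x\<^sub>3 \<mapsto> 0\<close> is not induced by a derivation.
\<close>

section \<open>Monomials and polynomials\<close>

abbreviation lookup where "lookup \<equiv> Poly_Mapping.lookup"
abbreviation keys where "keys \<equiv> Poly_Mapping.keys"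

definition unit_exp :: "nat \<Rightarrow> nat \<Rightarrow>\<^sub>0 nat" where
  "unit_exp i = Poly_Mapping.single i 1"

lemma lookup_unit_exp: "lookup (unit_exp i) j = (if i = j then 1 else 0)"
  by (simp add: unit_exp_def lookup_single when_def)

lemma poly_ring_simps [simp]:
  "p \<otimes>\<^bsub>poly_ring n\<^esub> q = p * q" "p \<oplus>\<^bsub>poly_ring n\<^esub> q = p + q"
  "\<one>\<^bsub>poly_ring n\<^esub> = 1" "\<zero>\<^bsub>poly_ring n\<^esub> = 0"
  by (simp_all add: poly_ring_def)

lemma carrier_poly_ring:
  "p \<in> carrier (poly_ring n) \<longleftrightarrow> (\<forall>m. lookup p m \<noteq> 0 \<longrightarrow> keys m \<subseteq> {1..n})"
  by (auto simp: poly_ring_def in_keys_iff)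

lemma keys_plus_nat: "keys (a + b) = keys a \<union> keys (b :: nat \<Rightarrow>\<^sub>0 nat)"
  by (auto simp: in_keys_iff lookup_add)

lemma keys_unit_exp [simp]: "keys (unit_exp i) = {i}"
  by (simp add: unit_exp_def)

lemma poly_var_eq: "poly_var i = Poly_Mapping.single (unit_exp i) 1"
  by (simp add: poly_var_def unit_exp_def)

text \<open>Restates \<open>update_induct\<close> additively, so that additive maps can be checked
  one monomial at a time.\<close>

lemma poly_mapping_monomial_induct [case_names zero plus]:
  fixes p :: "'a \<Rightarrow>\<^sub>0 'b::comm_monoid_add"
  assumes "P 0" "\<And>m c p. P p \<Longrightarrow> m \<notin> keys p \<Longrightarrow> P (p + Poly_Mapping.single m c)"
  shows "P p"
proof (induction p rule: update_induct)
  case const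
  then show ?case using assms(1) .
next
  case (update p a b)
  have "Poly_Mapping.update a b p = p + Poly_Mapping.single a b"
    using update(1) by (intro poly_mapping_eqI)
      (auto simp: lookup_update lookup_add lookup_single when_def in_keys_iff)
  then show ?case using assms(2) update by metis
qed

text \<open>Subtraction of exponents truncates at 0. Without the test \<open>k \<in> keys m\<close>,
  the coefficient of \<open>p\<close> at \<open>m\<close> itself would be returned whenever x_k does
  not divide m.\<close>

lemma lookup_var_times:
  "lookup (poly_var k * p) m = (if k \<in> keys m then lookup p (m - unit_exp k) else 0)"
proof (induction p rule: poly_mapping_monomial_induct)
  case (plus a c p)
  have "unit_exp k + a = m \<longleftrightarrow> k \<in> keys m \<and> a = m - unit_exp k"
    by (auto simp: keys_plus_nat poly_mapping_eq_iff fun_eq_iff lookup_add lookup_minus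
        lookup_unit_exp in_keys_iff)
  with plus(1) show ?case
    by (auto simp: lookup_add lookup_single when_def distrib_left poly_var_eq mult_single)
qed auto

lemma lookup_var_times' [simp]:
  "lookup (poly_var k * p) (m + unit_exp k) = lookup p m"
  by (simp add: lookup_var_times keys_plus_nat)

lemma lookup_const_times: "lookup (Poly_Mapping.single 0 c * p) m = c * lookup p m"
  by (induction p rule: poly_mapping_monomial_induct)
     (auto simp: lookup_add lookup_single when_def distrib_left mult_single)

lemma monom_eq_var_times:
  "Poly_Mapping.single (m + unit_exp k) c = poly_var k * Poly_Mapping.single m c"
  by (simp add: poly_var_eq mult_single add.commute)

lemma monomial_induct [case_names zero plus]:
  fixes m :: "nat \<Rightarrow>\<^sub>0 nat"
  assumes "P 0" and "\<And>m k. P m \<Longrightarrow> P (m + unit_exp k)"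
  shows "P m"
proof (induction m rule: poly_mapping_monomial_induct)
  case (plus i c m)
  have "P (m + Poly_Mapping.single i c)"
  proof (induction c)
    case (Suc c)
    have "m + Poly_Mapping.single i (Suc c) = (m + Poly_Mapping.single i c) + unit_exp i"
      by (simp add: unit_exp_def add.assoc flip: single_add)
    with assms(2)[OF Suc] show ?case by simp
  qed (use plus in simp)
  then show ?case .
qed (rule assms)

text \<open>Every monomial arises from a constant by repeated multiplication with variables, so a
  claim about arbitrary products reduces to multiplication by a single variable.\<close>

lemma mpoly_induct [case_names const plus var]:
  fixes p :: "'k::field mpoly"
  assumes "\<And>c. P (Poly_Mapping.single 0 c)" "\<And>p q. P p \<Longrightarrow> P q \<Longrightarrow> P (p + q)"
    "\<And>k p. P p \<Longrightarrow> P (poly_var k * p)"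
  shows "P p"
proof (induction p rule: poly_mapping_monomial_induct)
  case zero
  then show ?case using assms(1)[of 0] by simp
next
  case (plus m c p)
  have "P (Poly_Mapping.single m c)"
    by (induction m rule: monomial_induct) (simp_all only: assms monom_eq_var_times)
  with plus show ?case using assms by blast
qed

section \<open>The polynomial ring in n variables as a commutative ring\<close>

lemma poly_var_carrier [simp]: "i \<in> {1..n} \<Longrightarrow> poly_var i \<in> carrier (poly_ring n)"
  by (simp add: poly_ring_def poly_var_eq)

lemma poly_ring_closed [simp]:
  assumes "p \<in> carrier (poly_ring n)" "q \<in> carrier (poly_ring n)"
  shows "p + q \<in> carrier (poly_ring n)" "p * q \<in> carrier (poly_ring n)"
    "p - q \<in> carrier (poly_ring n)"
proof -
  show "p + q \<in> carrier (poly_ring n)"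
    using assms unfolding carrier_poly_ring lookup_add by (metis add_0)
  show "p - q \<in> carrier (poly_ring n)"
    using assms unfolding carrier_poly_ring lookup_minus by (metis diff_self)
  show "p * q \<in> carrier (poly_ring n)"
    using assms keys_mult[of p q] unfolding poly_ring_def by (fastforce simp: keys_plus_nat)
qed

lemma poly_ring_uminus [simp]: "- p \<in> carrier (poly_ring n) \<longleftrightarrow> p \<in> carrier (poly_ring n)"
  by (simp add: carrier_poly_ring)

lemma poly_ring_consts [simp]:
  "0 \<in> carrier (poly_ring n)" "1 \<in> carrier (poly_ring n)"
  "Poly_Mapping.single 0 c \<in> carrier (poly_ring n)"
  by (auto simp: poly_ring_def)

lemma poly_ring_sum [simp]:
  "(\<And>i. i \<in> A \<Longrightarrow> p i \<in> carrier (poly_ring n)) \<Longrightarrow> sum p A \<in> carrier (poly_ring n)"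
  by (induction A rule: infinite_finite_induct) auto

lemma cring_poly_ring: "cring (poly_ring n)"
proof (rule cringI)
  show "abelian_group (poly_ring n)"
  proof (rule abelian_groupI)
    fix x assume "x \<in> carrier (poly_ring n)"
    then show "\<exists>y\<in>carrier (poly_ring n). y \<oplus>\<^bsub>poly_ring n\<^esub> x = \<zero>\<^bsub>poly_ring n\<^esub>"
      by (intro bexI[of _ "-x"]) auto
  qed (auto simp: algebra_simps)
  show "comm_monoid (poly_ring n)"
    by (rule comm_monoidI) (auto simp: algebra_simps)
qed (auto simp: algebra_simps)

lemma a_minus_poly_ring [simp]:
  assumes "p \<in> carrier (poly_ring n)" "q \<in> carrier (poly_ring n)"
  shows "p \<ominus>\<^bsub>poly_ring n\<^esub> q = p - q"
proof -
  interpret cring "poly_ring n" by (rule cring_poly_ring)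
  have "\<ominus>\<^bsub>poly_ring n\<^esub> q = - q" using assms by (intro minus_equality) auto
  then show ?thesis by (simp add: a_minus_def)
qed

section \<open>Partial derivatives, division by a variable, and derivations\<close>

definition partial :: "nat \<Rightarrow> 'k::field mpoly \<Rightarrow> 'k mpoly" where
  "partial i p = Poly_Mapping.map_key (\<lambda>m. m + unit_exp i)
    (Poly_Mapping.mapp (\<lambda>m c. of_nat (lookup m i) * c) p)"

text \<open>A linear left inverse of multiplication by x_i: monomials not divisible by x_i lie
  outside the image of the shift and are dropped.\<close>

definition divide_var :: "nat \<Rightarrow> 'k::field mpoly \<Rightarrow> 'k mpoly" where
  "divide_var i p = Poly_Mapping.map_key (\<lambda>m. m + unit_exp i) p"

lemma inj_plus_unit_exp: "inj (\<lambda>m. m + unit_exp i)"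
  by (simp add: inj_def)

lemma lookup_partial: "lookup (partial i p) m = of_nat (lookup m i + 1) * lookup p (m + unit_exp i)"
  by (simp add: partial_def map_key.rep_eq[OF inj_plus_unit_exp] lookup_mapp when_def in_keys_iff
      lookup_add lookup_unit_exp)

lemma lookup_divide_var: "lookup (divide_var i p) m = lookup p (m + unit_exp i)"
  by (simp add: divide_var_def map_key.rep_eq[OF inj_plus_unit_exp])

lemma partial_add: "partial i (p + q) = partial i p + partial i q"
  by (rule poly_mapping_eqI) (simp add: lookup_partial lookup_add distrib_left)

lemma divide_var_add: "divide_var i (p + q) = divide_var i p + divide_var i q"
  by (rule poly_mapping_eqI) (simp add: lookup_divide_var lookup_add)

lemma partial_const_times:
  "partial i (Poly_Mapping.single 0 c * p) = Poly_Mapping.single 0 c * partial i p"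
  by (rule poly_mapping_eqI) (simp add: lookup_partial lookup_const_times mult.left_commute)

lemma plus_unit_exp_neq_zero [simp]: "m + unit_exp i \<noteq> 0"
  using keys_plus_nat[of m "unit_exp i"] by auto

lemma partial_const: "partial i (Poly_Mapping.single 0 c) = 0"
  by (rule poly_mapping_eqI) (simp add: lookup_partial lookup_single_not_eq)

lemma plus_minus_unit_exp: "i \<noteq> k \<Longrightarrow> m + unit_exp i - unit_exp k = m - unit_exp k + unit_exp i"
  by (auto simp: poly_mapping_eq_iff fun_eq_iff lookup_add lookup_minus lookup_unit_exp)

lemma minus_plus_unit_exp: "k \<in> keys m \<Longrightarrow> m - unit_exp k + unit_exp k = m"
  by (auto simp: poly_mapping_eq_iff fun_eq_iff lookup_add lookup_minus lookup_unit_exp in_keys_iff)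

lemma partial_var_times:
  "partial i (poly_var k * p) = poly_var k * partial i p + (if i = k then p else 0)"
proof (rule poly_mapping_eqI)
  fix m show "lookup (partial i (poly_var k * p)) m =
    lookup (poly_var k * partial i p + (if i = k then p else 0)) m"
  proof (cases "i = k")
    case True
    then show ?thesis
      by (cases "k \<in> keys m")
        (auto simp: lookup_partial lookup_add lookup_var_times' lookup_var_times[of _ _ m]
          lookup_minus lookup_unit_exp minus_plus_unit_exp distrib_right in_keys_iff of_nat_diff)
  next
    case False
    then show ?thesis
      by (auto simp: lookup_partial lookup_var_times keys_plus_nat
          lookup_minus lookup_unit_exp plus_minus_unit_exp)
  qed
qed

lemma divide_var_same [simp]: "divide_var i (poly_var i * p) = p"
  by (rule poly_mapping_eqI) (simp add: lookup_divide_var)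

lemma divide_var_other: "i \<noteq> k \<Longrightarrow> divide_var i (poly_var k * p) = poly_var k * divide_var i p"
  by (rule poly_mapping_eqI)
     (simp add: lookup_divide_var lookup_var_times plus_minus_unit_exp keys_plus_nat)

lemma partial_mult: "partial i (p * q) = p * partial i q + q * partial i p"
proof (induction p rule: mpoly_induct)
  case (const c)
  then show ?case by (simp add: partial_const_times partial_const)
next
  case (var k p)
  then show ?case by (simp add: partial_var_times mult.assoc) (simp add: algebra_simps)
qed (simp add: partial_add algebra_simps)

lemma partial_var: "partial i (poly_var k :: 'k::field mpoly) = (if i = k then 1 else 0)"
  using partial_var_times[of i k "1 :: 'k mpoly"] partial_const[of i "1 :: 'k"] by simp

lemma partial_carrier [simp]:
  "p \<in> carrier (poly_ring n) \<Longrightarrow> partial i p \<in> carrier (poly_ring n)"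
  unfolding carrier_poly_ring lookup_partial by (metis keys_plus_nat le_sup_iff mult_zero_right)

lemma divide_var_carrier [simp]:
  "p \<in> carrier (poly_ring n) \<Longrightarrow> divide_var i p \<in> carrier (poly_ring n)"
  unfolding carrier_poly_ring lookup_divide_var by (metis keys_plus_nat le_sup_iff)

text \<open>The sum of the g_i times the partial derivatives works: each partial obeys the Leibniz
  rule and sends a variable to 0 or 1.\<close>

lemma exists_derivation:
  fixes g :: "nat \<Rightarrow> 'k::field mpoly"
  assumes "\<And>i. i \<in> {1..n} \<Longrightarrow> g i \<in> carrier (poly_ring n)"
  obtains d where "d \<in> derivations poly_consts (poly_ring n)"
    "\<And>i. i \<in> {1..n} \<Longrightarrow> d (poly_var i) = g i"
proof
  let ?d = "\<lambda>f\<in>carrier (poly_ring n). \<Sum>i\<in>{1..n}. g i * partial i f"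
  show "?d \<in> derivations poly_consts (poly_ring n)"
    using assms unfolding derivations_def poly_consts_def
    by (auto simp: partial_add partial_const_times partial_const partial_mult
        sum.distrib sum_distrib_left algebra_simps intro!: poly_ring_sum)
  show "?d (poly_var i) = g i" if "i \<in> {1..n}" for i
    using that by (simp add: partial_var if_distrib cong: if_cong)
qed

section \<open>Homomorphisms and edge ideals\<close>

text \<open>Replaces coset-valued homomorphisms by functions \<open>H\<close> choosing
  representatives. The cokernel vanishes exactly when every homomorphism lies in the image of the
  derivations.\<close>

lemma rigid_iff:
  fixes n :: nat and E :: "nat set set"
  defines "S \<equiv> poly_ring n :: 'k::field mpoly ring"
  defines "I \<equiv> edge_ideal n E :: 'k mpoly set"
  assumes I: "ideal I S"
  shows "rigid TYPE('k) n E \<longleftrightarrow>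
    (\<forall>H. (\<forall>f\<in>I. H f \<in> carrier S) \<longrightarrow>
         (\<forall>f\<in>I. \<forall>g\<in>I. H (f + g) - (H f + H g) \<in> I) \<longrightarrow>
         (\<forall>r\<in>carrier S. \<forall>f\<in>I. H (r * f) - r * H f \<in> I) \<longrightarrow>
         (\<exists>d\<in>derivations poly_consts S. \<forall>f\<in>I. H f - d f \<in> I))"
proof -
  interpret cring S unfolding S_def by (rule cring_poly_ring)
  interpret ideal I S by (rule I)
  let ?M = "Hom_module S (ideal_module S I) (quot_ring_module S I)"
  let ?Der = "derivations poly_consts S"
  let ?N = "delta_star S I ` ?Der"
  have ops [simp]: "p \<otimes>\<^bsub>S\<^esub> q = p * q" "p \<oplus>\<^bsub>S\<^esub> q = p + q" "\<zero>\<^bsub>S\<^esub> = 0" for p q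
    by (simp_all add: S_def)
  have minus: "p \<ominus>\<^bsub>S\<^esub> q = p - q" if "p \<in> carrier S" "q \<in> carrier S" for p q
    using that by (simp add: S_def)
  have IS: "f \<in> carrier S" if "f \<in> I" for f using a_subset that by auto
  have sums: "f + g \<in> I" if "f \<in> I" "g \<in> I" for f g
    using add.m_closed that a_closed by fastforce
  have prods: "r * f \<in> I" if "f \<in> I" "r \<in> carrier S" for r f
    using I_l_closed that by fastforce
  have S: "p + q \<in> carrier S" "p * q \<in> carrier S" "p - q \<in> carrier S"
    if "p \<in> carrier S" "q \<in> carrier S" for p q
    using that unfolding S_def by simp_all
  have S0: "0 \<in> carrier S" unfolding S_def by simp
  have scal: "c \<in> carrier S" if "c \<in> poly_consts" for c
    using that unfolding S_def poly_consts_def by auto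
  have eq_iff: "I +>\<^bsub>S\<^esub> p = I +>\<^bsub>S\<^esub> q \<longleftrightarrow> p - q \<in> I" if "p \<in> carrier S" "q \<in> carrier S" for p q
    using quotient_eq_iff_same_a_r_cos[OF I that] minus[OF that] by simp
  have cadd: "(I +>\<^bsub>S\<^esub> p) <+>\<^bsub>S\<^esub> (I +>\<^bsub>S\<^esub> q) = I +>\<^bsub>S\<^esub> (p + q)"
    if "p \<in> carrier S" "q \<in> carrier S" for p q
    using a_rcos_sum[OF that] by simp
  have cmul: "[mod I:] (I +>\<^bsub>S\<^esub> p) \<Otimes>\<^bsub>S\<^esub> (I +>\<^bsub>S\<^esub> q) = I +>\<^bsub>S\<^esub> (p * q)"
    if "p \<in> carrier S" "q \<in> carrier S" for p q
    using rcoset_mult_add[OF that] by simp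
  have c0: "I +>\<^bsub>S\<^esub> 0 = I" using a_coset_add_zero[OF a_subset] by simp
  have cosets: "X \<in> a_rcosets\<^bsub>S\<^esub> I \<longleftrightarrow> (\<exists>p\<in>carrier S. X = I +>\<^bsub>S\<^esub> p)" for X
    by (auto simp: A_RCOSETS_def')
  have M: "h \<in> carrier ?M \<longleftrightarrow> h \<in> I \<rightarrow>\<^sub>E a_rcosets\<^bsub>S\<^esub> I \<and>
      (\<forall>f\<in>I. \<forall>g\<in>I. h (f + g) = h f <+>\<^bsub>S\<^esub> h g) \<and>
      (\<forall>r\<in>carrier S. \<forall>f\<in>I. h (r * f) = [mod I:] (I +>\<^bsub>S\<^esub> r) \<Otimes>\<^bsub>S\<^esub> h f)" for h
    by (simp add: Hom_module_def ideal_module_def quot_ring_module_def FactRing_def ring.defs module.defs)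
  have Madd: "g \<oplus>\<^bsub>?M\<^esub> h = (\<lambda>f\<in>I. g f <+>\<^bsub>S\<^esub> h f)" for g h
    by (simp add: Hom_module_def ideal_module_def quot_ring_module_def FactRing_def ring.defs module.defs)
  have Der: "d \<in> ?Der \<longleftrightarrow> d \<in> carrier S \<rightarrow>\<^sub>E carrier S \<and>
        (\<forall>f\<in>carrier S. \<forall>g\<in>carrier S. d (f + g) = d f + d g) \<and>
        (\<forall>c\<in>poly_consts. \<forall>f\<in>carrier S. d (c * f) = c * d f) \<and>
        (\<forall>f\<in>carrier S. \<forall>g\<in>carrier S. d (f * g) = f * d g + g * d f)" for d
    by (simp add: derivations_def)
  have dS: "d f \<in> carrier S" if "d \<in> ?Der" "f \<in> carrier S" for d f
    using that Der by auto
  have delta: "delta_star S I d = (\<lambda>f\<in>I. I +>\<^bsub>S\<^esub> d f)" for d by (simp add: delta_star_def)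
  have Der0: "(\<lambda>f\<in>carrier S. 0) \<in> ?Der"
    unfolding Der by (auto simp: S S0 scal)
  have Der_add: "(\<lambda>f\<in>carrier S. d f + e f) \<in> ?Der" if "d \<in> ?Der" "e \<in> ?Der" for d e
    using that dS[OF that(1)] dS[OF that(2)] unfolding Der by (auto simp: S scal algebra_simps)
  have Der_diff: "(\<lambda>f\<in>carrier S. d f - e f) \<in> ?Der" if "d \<in> ?Der" "e \<in> ?Der" for d e
    using that dS[OF that(1)] dS[OF that(2)] unfolding Der by (auto simp: S scal algebra_simps)
  have coset: "?N +>\<^bsub>?M\<^esub> h = {(\<lambda>f\<in>I. (I +>\<^bsub>S\<^esub> d f) <+>\<^bsub>S\<^esub> h f) | d. d \<in> ?Der}" for h
    by (auto simp: a_r_coset_def' Madd delta cong: restrict_cong)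
  have rigid: "rigid TYPE('k) n E \<longleftrightarrow> (\<forall>h\<in>carrier ?M. ?N +>\<^bsub>?M\<^esub> h = ?N)"
  proof -
    \<comment> \<open>The zero homomorphism guarantees that some coset exists; otherwise the carrier
      could be empty instead of a singleton.\<close>
    have "(\<lambda>f\<in>I. I +>\<^bsub>S\<^esub> 0) \<in> carrier ?M"
      unfolding M using S0 by (auto simp: cosets sums prods cadd cmul)
    then show ?thesis
      unfolding rigid_def Let_def T1_def quotient_module_def S_def[symmetric] I_def[symmetric]
      by (auto simp: A_RCOSETS_def')
  qed
  show ?thesis
  proof
    assume rig: "rigid TYPE('k) n E"
    show "\<forall>H. (\<forall>f\<in>I. H f \<in> carrier S) \<longrightarrow>
         (\<forall>f\<in>I. \<forall>g\<in>I. H (f + g) - (H f + H g) \<in> I) \<longrightarrow>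
         (\<forall>r\<in>carrier S. \<forall>f\<in>I. H (r * f) - r * H f \<in> I) \<longrightarrow>
         (\<exists>d\<in>?Der. \<forall>f\<in>I. H f - d f \<in> I)"
    proof (intro allI impI)
      fix H
      assume H: "\<forall>f\<in>I. H f \<in> carrier S" "\<forall>f\<in>I. \<forall>g\<in>I. H (f + g) - (H f + H g) \<in> I"
        "\<forall>r\<in>carrier S. \<forall>f\<in>I. H (r * f) - r * H f \<in> I"
      let ?h = "\<lambda>f\<in>I. I +>\<^bsub>S\<^esub> H f"
      have "?h \<in> I \<rightarrow>\<^sub>E a_rcosets\<^bsub>S\<^esub> I" using H(1) cosets by auto
      then have "?h \<in> carrier ?M"
        unfolding M using H by (auto simp: cosets sums prods cadd cmul eq_iff S IS)
      then have "?N +>\<^bsub>?M\<^esub> ?h = ?N" using rig rigid by blast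
      \<comment> \<open>The zero derivation shows that \<open>?h\<close> lies in its own coset,
        which is \<open>?N\<close>.\<close>
      moreover have "(\<lambda>f\<in>I. (I +>\<^bsub>S\<^esub> (\<lambda>f\<in>carrier S. 0) f) <+>\<^bsub>S\<^esub> ?h f) \<in> ?N +>\<^bsub>?M\<^esub> ?h"
        unfolding coset using Der0 by blast
      moreover have "(\<lambda>f\<in>I. (I +>\<^bsub>S\<^esub> (\<lambda>f\<in>carrier S. 0) f) <+>\<^bsub>S\<^esub> ?h f) = ?h"
        using H S0 IS by (intro restrict_ext) (simp add: cadd)
      ultimately have "?h \<in> ?N" by metis
      then obtain d where d: "d \<in> ?Der" "?h = (\<lambda>f\<in>I. I +>\<^bsub>S\<^esub> d f)" by (auto simp: delta)
      have "H f - d f \<in> I" if "f \<in> I" for f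
        using fun_cong[OF d(2), of f] that H(1) dS[OF d(1)] IS by (simp add: eq_iff)
      with d(1) show "\<exists>d\<in>?Der. \<forall>f\<in>I. H f - d f \<in> I" by blast
    qed
  next
    assume R: "\<forall>H. (\<forall>f\<in>I. H f \<in> carrier S) \<longrightarrow>
         (\<forall>f\<in>I. \<forall>g\<in>I. H (f + g) - (H f + H g) \<in> I) \<longrightarrow>
         (\<forall>r\<in>carrier S. \<forall>f\<in>I. H (r * f) - r * H f \<in> I) \<longrightarrow>
         (\<exists>d\<in>?Der. \<forall>f\<in>I. H f - d f \<in> I)"
    show "rigid TYPE('k) n E"
      unfolding rigid
    proof
      fix h assume h: "h \<in> carrier ?M"
      then have "\<forall>f\<in>I. \<exists>p\<in>carrier S. h f = I +>\<^bsub>S\<^esub> p" unfolding M by (auto simp: cosets PiE_iff)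
      then obtain H where H: "\<And>f. f \<in> I \<Longrightarrow> H f \<in> carrier S" "\<And>f. f \<in> I \<Longrightarrow> h f = I +>\<^bsub>S\<^esub> H f"
        by metis
      have "H (f + g) - (H f + H g) \<in> I" if "f \<in> I" "g \<in> I" for f g
      proof -
        have "h (f + g) = h f <+>\<^bsub>S\<^esub> h g" using h that unfolding M by blast
        then show ?thesis using that H by (simp add: cadd sums eq_iff S)
      qed
      moreover have "H (r * f) - r * H f \<in> I" if "r \<in> carrier S" "f \<in> I" for r f
      proof -
        have "h (r * f) = [mod I:] (I +>\<^bsub>S\<^esub> r) \<Otimes>\<^bsub>S\<^esub> h f" using h that unfolding M by blast
        then show ?thesis using that H by (simp add: cmul prods eq_iff S)
      qed
      ultimately obtain e where e: "e \<in> ?Der" "\<forall>f\<in>I. H f - e f \<in> I" using R H(1) by metis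
      have he: "h f = I +>\<^bsub>S\<^esub> e f" if "f \<in> I" for f
        using e(2) that H dS[OF e(1)] IS by (simp add: eq_iff)
      have sum_eq: "(\<lambda>f\<in>I. (I +>\<^bsub>S\<^esub> d f) <+>\<^bsub>S\<^esub> h f) = (\<lambda>f\<in>I. I +>\<^bsub>S\<^esub> (d f + e f))"
        if "d \<in> ?Der" for d
        using dS[OF e(1)] dS[OF that] IS by (intro restrict_ext) (simp add: he cadd)
      have "?N +>\<^bsub>?M\<^esub> h = {(\<lambda>f\<in>I. I +>\<^bsub>S\<^esub> (d f + e f)) | d. d \<in> ?Der}"
        unfolding coset by (intro Collect_cong ex_cong1) (auto simp: sum_eq)
      \<comment> \<open>Translation by \<open>e\<close> is invertible on derivations, so the coset
        is the whole image again.\<close>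
      also have "\<dots> = ?N"
      proof (intro equalityI subsetI)
        fix x assume "x \<in> {(\<lambda>f\<in>I. I +>\<^bsub>S\<^esub> (d f + e f)) | d. d \<in> ?Der}"
        then obtain d where d: "d \<in> ?Der" "x = (\<lambda>f\<in>I. I +>\<^bsub>S\<^esub> (d f + e f))" by blast
        have "x = delta_star S I (\<lambda>f\<in>carrier S. d f + e f)"
          unfolding d(2) delta using IS by (intro restrict_ext) simp
        with Der_add[OF d(1) e(1)] show "x \<in> ?N" by blast
      next
        fix x assume "x \<in> ?N"
        then obtain d where d: "d \<in> ?Der" "x = (\<lambda>f\<in>I. I +>\<^bsub>S\<^esub> d f)" by (auto simp: delta)
        have "x = (\<lambda>f\<in>I. I +>\<^bsub>S\<^esub> ((\<lambda>f\<in>carrier S. d f - e f) f + e f))"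
          unfolding d(2) using IS by (intro restrict_ext) simp
        with Der_diff[OF d(1) e(1)] show "x \<in> {(\<lambda>f\<in>I. I +>\<^bsub>S\<^esub> (d f + e f)) | d. d \<in> ?Der}" by blast
      qed
      finally show "?N +>\<^bsub>?M\<^esub> h = ?N" .
    qed
  qed
qed

section \<open>Edge ideals as monomial ideals\<close>

lemma ideal_edge_ideal:
  assumes "simple_graph n E"
  shows "ideal (edge_ideal n E) (poly_ring n)"
proof -
  interpret cring "poly_ring n" by (rule cring_poly_ring)
  show ?thesis unfolding edge_ideal_def
    using assms by (intro genideal_ideal) (auto simp: simple_graph_def)
qed

lemma edge_mem_edge_ideal:
  assumes "simple_graph n E" "{i, j} \<in> E"
  shows "poly_var i * poly_var j \<in> edge_ideal n E"
proof -
  let ?S = "poly_ring n :: 'a mpoly ring"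
  interpret cring ?S by (rule cring_poly_ring)
  let ?G = "{poly_var i \<otimes>\<^bsub>?S\<^esub> poly_var j | i j. {i, j} \<in> E}"
  have "?G \<subseteq> carrier ?S" using assms(1) by (auto simp: simple_graph_def)
  then have "?G \<subseteq> edge_ideal n E" unfolding edge_ideal_def by (rule genideal_self)
  moreover have "poly_var i * poly_var j \<in> ?G" using assms(2) by auto
  ultimately show ?thesis by blast
qed

text \<open>The polynomials all of whose monomials contain an edge form an ideal containing the
  generators; conversely each such monomial is a multiple of a generator.\<close>

lemma mem_edge_ideal_iff:
  assumes "simple_graph n E"
  shows "p \<in> edge_ideal n E \<longleftrightarrow>
    p \<in> carrier (poly_ring n) \<and> (\<forall>m. (\<forall>e\<in>E. \<not> e \<subseteq> keys m) \<longrightarrow> lookup p m = 0)"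
proof
  interpret cring "poly_ring n" by (rule cring_poly_ring)
  let ?S = "poly_ring n :: 'a mpoly ring"
  let ?G = "{poly_var i \<otimes>\<^bsub>?S\<^esub> poly_var j | i j. {i, j} \<in> E}"
  let ?V = "{p. \<forall>m. (\<forall>e\<in>E. \<not> e \<subseteq> keys m) \<longrightarrow> lookup p m = 0}"
  let ?J = "carrier ?S \<inter> ?V"
  have V: "r * p \<in> ?V" if "p \<in> ?V" for r p :: "'a mpoly"
  proof (induction r rule: mpoly_induct)
    case (var k r)
    have "keys (m - unit_exp k) \<subseteq> keys m" for m by (auto simp: in_keys_iff lookup_minus)
    with var show ?case by (fastforce simp: mult.assoc lookup_var_times)
  qed (use that in \<open>auto simp: lookup_const_times distrib_right lookup_add\<close>)
  have "ideal ?J ?S"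
  proof (rule idealI)
    show "subgroup ?J (add_monoid ?S)"
    proof (rule add.subgroupI)
      fix a assume a: "a \<in> ?J"
      have "\<ominus>\<^bsub>?S\<^esub> a = - a" using a by (intro minus_equality) auto
      then show "\<ominus>\<^bsub>?S\<^esub> a \<in> ?J" using a by auto
    qed (auto simp: lookup_add)
  qed (use V in \<open>auto simp: ring_axioms mult.commute\<close>)
  moreover have "?G \<subseteq> ?J"
  proof clarify
    fix i j assume ij: "{i, j} \<in> E"
    \<comment> \<open>The factor 1 lets \<open>lookup_var_times\<close> apply to both
      variables.\<close>
    have "lookup (poly_var i * (poly_var j * 1 :: 'a mpoly)) m = 0"
      if "\<forall>e\<in>E. \<not> e \<subseteq> keys m" for m
      using bspec[OF that ij] by (auto simp del: mult_1_right
          simp: lookup_var_times in_keys_iff lookup_minus lookup_unit_exp)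
    moreover have "i \<in> {1..n}" "j \<in> {1..n}" using assms ij by (auto simp: simple_graph_def)
    ultimately show "poly_var i \<otimes>\<^bsub>?S\<^esub> poly_var j \<in> ?J" using ij by auto
  qed
  ultimately have "edge_ideal n E \<subseteq> ?J" unfolding edge_ideal_def by (rule genideal_minimal)
  then show "p \<in> carrier ?S \<and> (\<forall>m. (\<forall>e\<in>E. \<not> e \<subseteq> keys m) \<longrightarrow> lookup p m = 0)"
    if "p \<in> edge_ideal n E" using that by auto
next
  let ?S = "poly_ring n :: 'a mpoly ring"
  interpret cring ?S by (rule cring_poly_ring)
  interpret ideal "edge_ideal n E" ?S by (rule ideal_edge_ideal[OF assms])
  have "\<lbrakk>\<And>m. m \<in> keys p \<Longrightarrow> keys m \<subseteq> {1..n} \<and> (\<exists>e\<in>E. e \<subseteq> keys m)\<rbrakk> \<Longrightarrow> p \<in> edge_ideal n E"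
  proof (induction p rule: poly_mapping_monomial_induct)
    case zero
    then show ?case using additive_subgroup.zero_closed[OF is_additive_subgroup] by simp
  next
    case (plus m c p)
    have "p \<in> edge_ideal n E"
      using plus by (intro plus.IH plus.prems) (auto simp: in_keys_iff lookup_add lookup_single when_def)
    moreover have "Poly_Mapping.single m c \<in> edge_ideal n E"
    proof (cases "c = 0")
      case False
      have "m \<in> keys (p + Poly_Mapping.single m c)"
        using plus(2) False by (auto simp: in_keys_iff lookup_add)
      then obtain e where m: "keys m \<subseteq> {1..n}" and e: "e \<in> E" "e \<subseteq> keys m"
        using plus.prems by blast
      from e assms obtain i j where ij: "e = {i, j}" "i \<noteq> j" by (auto simp: simple_graph_def card_2_iff)
      let ?m = "m - unit_exp i - unit_exp j"
      \<comment> \<open>As \<open>i\<close> and \<open>j\<close> are distinct and both occur in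
        \<open>m\<close>, neither subtraction truncates.\<close>
      have "m = ?m + unit_exp j + unit_exp i"
        using e(2) unfolding ij
        by (subst minus_plus_unit_exp;
          auto simp: minus_plus_unit_exp in_keys_iff lookup_minus lookup_unit_exp ij)
      then have eq: "Poly_Mapping.single m c = Poly_Mapping.single ?m c * (poly_var i * poly_var j)"
        by (metis monom_eq_var_times mult.assoc mult.commute)
      have "Poly_Mapping.single ?m c \<in> carrier ?S"
        using m by (auto simp: poly_ring_def in_keys_iff lookup_minus)
      moreover have "poly_var i * poly_var j \<in> edge_ideal n E"
        using e(1) unfolding ij by (rule edge_mem_edge_ideal[OF assms])
      ultimately show ?thesis using I_l_closed unfolding eq by simp
    qed (use additive_subgroup.zero_closed[OF is_additive_subgroup] in simp)
    ultimately show ?case using additive_subgroup.a_closed[OF is_additive_subgroup] by fastforce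
  qed
  then show "p \<in> edge_ideal n E"
    if "p \<in> carrier ?S \<and> (\<forall>m. (\<forall>e\<in>E. \<not> e \<subseteq> keys m) \<longrightarrow> lookup p m = 0)"
    using that by (metis carrier_poly_ring in_keys_iff)
qed

section \<open>Rigidity criteria\<close>

locale simple_graph_ideal =
  fixes n :: nat and E :: "nat set set" and K :: "'k::field itself"
  assumes graph: "simple_graph n E"
begin

abbreviation S :: "'k mpoly ring" where "S \<equiv> poly_ring n"
abbreviation I :: "'k mpoly set" where "I \<equiv> edge_ideal n E"

definition indep :: "nat set \<Rightarrow> bool" where
  "indep F \<longleftrightarrow> (\<forall>e\<in>E. \<not> e \<subseteq> F)"

text \<open>A homomorphism \<open>I \<rightarrow> S/I\<close> is represented by an arbitrary function that picks a representative
  of each value; conversely every such function modulo \<open>I\<close> is a homomorphism.\<close>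

definition hom_lift :: "('k mpoly \<Rightarrow> 'k mpoly) \<Rightarrow> bool" where
  "hom_lift H \<longleftrightarrow> (\<forall>f\<in>I. H f \<in> carrier S) \<and>
     (\<forall>f\<in>I. \<forall>g\<in>I. H (f + g) - (H f + H g) \<in> I) \<and>
     (\<forall>r\<in>carrier S. \<forall>f\<in>I. H (r * f) - r * H f \<in> I)"

lemma rigid_iff_hom_lift:
  "rigid K n E \<longleftrightarrow>
    (\<forall>H. hom_lift H \<longrightarrow> (\<exists>d\<in>derivations poly_consts S. \<forall>f\<in>I. H f - d f \<in> I))"
proof -
  have "rigid K n E = rigid TYPE('k) n E" by (simp add: rigid_def)
  then show ?thesis
    using rigid_iff[OF ideal_edge_ideal[OF graph]] unfolding hom_lift_def by auto
qed

section \<open>Membership in the edge ideal, by coefficients and by generators\<close>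

lemma mem_I_iff:
  "p \<in> I \<longleftrightarrow> p \<in> carrier S \<and> (\<forall>m. indep (keys m) \<longrightarrow> lookup p m = 0)"
  unfolding mem_edge_ideal_iff[OF graph] indep_def ..

lemma I_carrier: "p \<in> I \<Longrightarrow> p \<in> carrier S"
  by (simp add: mem_I_iff)

lemma I_zero [simp]: "0 \<in> I"
  by (simp add: mem_I_iff)

lemma I_add: "p \<in> I \<Longrightarrow> q \<in> I \<Longrightarrow> p + q \<in> I"
  by (simp add: mem_I_iff lookup_add)

lemma I_diff: "p \<in> I \<Longrightarrow> q \<in> I \<Longrightarrow> p - q \<in> I"
  by (simp add: mem_I_iff lookup_minus)

lemma I_mult:
  assumes "r \<in> carrier S" "p \<in> I"
  shows "r * p \<in> I"
  using ideal.I_l_closed[OF ideal_edge_ideal[OF graph] assms(2,1)] by simp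

lemma edgeD:
  assumes "{i, j} \<in> E"
  shows "i \<noteq> j" "i \<in> {1..n}" "j \<in> {1..n}" "poly_var i \<in> carrier S" "poly_var j \<in> carrier S"
proof -
  have "{i, j} \<subseteq> {1..n}" and card: "card {i, j} = 2"
    using graph assms unfolding simple_graph_def by blast+
  then show "i \<in> {1..n}" "j \<in> {1..n}" by blast+
  then show "poly_var i \<in> carrier S" "poly_var j \<in> carrier S" by (blast intro: poly_var_carrier)+
  show "i \<noteq> j" using card by auto
qed

lemma edge_mem_I:
  assumes "{i, j} \<in> E"
  shows "poly_var i * poly_var j \<in> I"
  using edge_mem_edge_ideal[OF graph assms] .

text \<open>The members of \<open>I\<close> satisfying \<open>P\<close> form an ideal that contains
  the generators; negation is multiplication by -1.\<close>

lemma I_induct [consumes 1, case_names zero edge add mult]: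
  assumes "f \<in> I" and "P 0"
    and "\<And>i j. {i, j} \<in> E \<Longrightarrow> P (poly_var i * poly_var j)"
    and "\<And>f g. f \<in> I \<Longrightarrow> g \<in> I \<Longrightarrow> P f \<Longrightarrow> P g \<Longrightarrow> P (f + g)"
    and "\<And>r f. r \<in> carrier S \<Longrightarrow> f \<in> I \<Longrightarrow> P f \<Longrightarrow> P (r * f)"
  shows "P f"
proof -
  interpret cring S by (rule cring_poly_ring)
  let ?J = "{f \<in> I. P f}"
  have mult: "r * f \<in> ?J" if "r \<in> carrier S" "f \<in> ?J" for r f
    using that assms(5) I_mult by auto
  have "ideal ?J S"
  proof (rule idealI)
    show "subgroup ?J (add_monoid S)"
    proof (rule add.subgroupI)
      fix a assume a: "a \<in> ?J"
      have "\<ominus>\<^bsub>S\<^esub> a = (- 1) * a" using a by (intro minus_equality) (auto dest: I_carrier)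
      with mult[OF _ a, of "-1"] show "\<ominus>\<^bsub>S\<^esub> a \<in> ?J" by simp
    next
      show "?J \<noteq> {}" using I_zero assms(2) by blast
    qed (use I_carrier I_add assms(4) in auto)
  next
    fix a x assume "a \<in> ?J" "x \<in> carrier S"
    then show "x \<otimes>\<^bsub>S\<^esub> a \<in> ?J" "a \<otimes>\<^bsub>S\<^esub> x \<in> ?J"
      using mult[of x a] by (simp_all add: mult.commute[of a x])
  qed (rule ring_axioms)
  moreover have "{poly_var i \<otimes>\<^bsub>S\<^esub> poly_var j | i j. {i, j} \<in> E} \<subseteq> ?J"
    using edge_mem_I assms(3) by auto
  ultimately have "I \<subseteq> ?J" unfolding edge_ideal_def by (rule genideal_minimal)
  with assms(1) show ?thesis by blast
qed

text \<open>Choose the derivation sending each x_i to g_i. Restricted to \<open>I\<close> and read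
  modulo \<open>I\<close>, it is S-linear like \<open>H\<close>, so agreement on the generators
  suffices.\<close>

lemma rigidI:
  assumes "\<And>H. hom_lift H \<Longrightarrow> \<exists>g. (\<forall>i\<in>{1..n}. g i \<in> carrier S) \<and>
    (\<forall>i j. {i, j} \<in> E \<longrightarrow>
       H (poly_var i * poly_var j) - (poly_var i * g j + poly_var j * g i) \<in> I)"
  shows "rigid K n E"
  unfolding rigid_iff_hom_lift
proof (intro allI impI)
  fix H assume H: "hom_lift H"
  from assms[OF H] obtain g where g: "\<And>i. i \<in> {1..n} \<Longrightarrow> g i \<in> carrier S"
    "\<And>i j. {i, j} \<in> E \<Longrightarrow>
       H (poly_var i * poly_var j) - (poly_var i * g j + poly_var j * g i) \<in> I" by blast
  obtain d where d: "d \<in> derivations poly_consts S" "\<And>i. i \<in> {1..n} \<Longrightarrow> d (poly_var i) = g i"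
    using exists_derivation[of n g] g(1) by blast
  have dS: "d f \<in> carrier S" "d (f + g) = d f + d g" "d (f * g) = f * d g + g * d f"
    if "f \<in> carrier S" "g \<in> carrier S" for f g
    using d(1) that unfolding derivations_def by auto
  have "H f - d f \<in> I" if "f \<in> I" for f
    using that
  proof (induction rule: I_induct)
    case zero
    have "H (0 * 0) - 0 * H 0 \<in> I" using H unfolding hom_lift_def by (meson I_zero I_carrier)
    moreover have "d 0 = 0" using dS(3)[of 0 0] by simp
    ultimately show ?case by simp
  next
    case (edge i j)
    then show ?case using g(2)[OF edge] edgeD[OF edge] by (simp add: dS d(2))
  next
    case (add f g)
    then have "H (f + g) - (H f + H g) \<in> I" using H unfolding hom_lift_def by blast
    from I_add[OF this I_add[OF add(3,4)]] show ?case
      using add(1,2) by (simp add: I_carrier dS algebra_simps)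
  next
    case (mult r f)
    then have "H (r * f) - r * H f \<in> I" using H unfolding hom_lift_def by blast
    moreover have "r * (H f - d f) \<in> I" using mult by (intro I_mult[OF mult(1)])
    moreover have "d r \<in> carrier S" using mult I_carrier dS(1) by blast
    \<comment> \<open>This Leibniz term is what keeps \<open>d\<close> from being S-linear; it
      vanishes modulo \<open>I\<close> because \<open>f\<close> lies in \<open>I\<close>.\<close>
    then have "d r * f \<in> I" using mult(2) by (rule I_mult)
    ultimately have "(H (r * f) - r * H f) + r * (H f - d f) - d r * f \<in> I"
      using I_diff[OF I_add] by blast
    then show ?case using mult(1,2) by (simp add: I_carrier dS algebra_simps)
  qed
  with d(1) show "\<exists>d\<in>derivations poly_consts S. \<forall>f\<in>I. H f - d f \<in> I" by blast
qed

text \<open>The homomorphism tested here is \<open>f \<mapsto> q * (f / (x\<^sub>i * x\<^sub>j))\<close>, where the division drops all monomials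
  that are not divisible by \<open>x\<^sub>i * x\<^sub>j\<close>; it is \<open>S\<close>-linear only modulo \<open>I\<close> and only on \<open>I\<close>.\<close>

lemma rigid_edge_hom:
  assumes rigid: "rigid K n E" and ij: "{i, j} \<in> E" and q: "q \<in> carrier S"
    and nb: "\<And>k. k \<notin> {i, j} \<Longrightarrow> {i, k} \<in> E \<or> {j, k} \<in> E \<Longrightarrow> q * poly_var k \<in> I"
  obtains g where "\<And>k. k \<in> {1..n} \<Longrightarrow> g k \<in> carrier S"
    "q - (poly_var i * g j + poly_var j * g i) \<in> I"
    "\<And>k l. {k, l} \<in> E \<Longrightarrow> {k, l} \<noteq> {i, j} \<Longrightarrow> poly_var k * g l + poly_var l * g k \<in> I"
proof -
  define D :: "'k mpoly \<Rightarrow> 'k mpoly" where "D f = divide_var i (divide_var j f)" for f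
  have D_S: "D f \<in> carrier S" if "f \<in> carrier S" for f using that by (simp add: D_def)
  have D_add: "D (f + g) = D f + D g" for f g by (simp add: D_def divide_var_add)
  have D_var: "D (poly_var k * f) = poly_var k * D f" if "k \<notin> {i, j}" for k f
    using that by (simp add: D_def divide_var_other)
  have ij_ne: "i \<noteq> j" using edgeD(1)[OF ij] .
  have D_ij: "D (r * (poly_var i * poly_var j)) = r" for r
    using ij_ne by (simp add: D_def mult.left_commute[of _ "poly_var j"] mult.commute[of r] mult.assoc)
  \<comment> \<open>Some endpoint k lies outside the edge ij. If l lies on it, k is a neighbour of i
    or j and q * x_k is in \<open>I\<close>; otherwise both variables pass through \<open>D\<close>
    and x_k * x_l survives as a factor.\<close>
  have other: "q * D (p * (poly_var k * poly_var l)) \<in> I"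
    if "{k, l} \<in> E" "{k, l} \<noteq> {i, j}" "p \<in> carrier S" for k l p
  proof -
    have *: "q * D (poly_var k * (poly_var l * p)) \<in> I"
      if kl: "{k, l} \<in> E" and k: "k \<notin> {i, j}" for k l
    proof (cases "l \<in> {i, j}")
      case True
      then have "q * poly_var k \<in> I" using kl k nb by (metis insert_commute insertE singletonD)
      moreover have "D (poly_var l * p) \<in> carrier S"
        using edgeD(5)[OF kl] \<open>p \<in> carrier S\<close> by (intro D_S) simp
      ultimately have "D (poly_var l * p) * (q * poly_var k) \<in> I" by (rule I_mult[rotated])
      then show ?thesis unfolding D_var[OF k] by (simp add: mult_ac)
    next
      case False
      have "(q * D p) * (poly_var k * poly_var l) \<in> I"
        using q \<open>p \<in> carrier S\<close> D_S by (intro I_mult[OF _ edge_mem_I[OF kl]]) simp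
      then show ?thesis unfolding D_var[OF k] D_var[OF False] by (simp add: mult_ac)
    qed
    have "k \<notin> {i, j} \<or> l \<notin> {i, j}" using that(2) edgeD(1)[OF that(1)] by auto
    then show ?thesis
      using *[of k l] *[of l k] that(1) by (auto simp: insert_commute mult_ac)
  qed
  have "hom_lift (\<lambda>f. q * D f)"
    unfolding hom_lift_def
  proof (intro conjI ballI)
    fix r f assume r: "r \<in> carrier S" and f: "f \<in> I"
    have "D 0 = 0" by (rule poly_mapping_eqI) (simp add: D_def lookup_divide_var)
    \<comment> \<open>Quantifying over all \<open>r\<close> strengthens the induction: the
      multiplication step uses the hypothesis at \<open>r * s\<close> and at
      \<open>s\<close>.\<close>
    from f have "\<forall>r\<in>carrier S. q * D (r * f) - r * (q * D f) \<in> I"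
    proof (induction rule: I_induct)
      case zero
      show ?case using \<open>D 0 = 0\<close> by simp
    next
      case (edge k l)
      show ?case
      proof (cases "{k, l} = {i, j}")
        case True
        then have "poly_var k * poly_var l = poly_var i * (poly_var j :: 'k mpoly)"
          by (auto simp: doubleton_eq_iff mult.commute)
        then show ?thesis using D_ij D_ij[of 1] by (simp add: mult.left_commute)
      next
        case False
        have "q * D (poly_var k * poly_var l) \<in> I" using other[OF edge False, of 1] by simp
        then show ?thesis using other[OF edge False] I_diff I_mult by blast
      qed
    next
      case (add f g)
      show ?case
      proof
        fix r assume "r \<in> carrier S"
        with add have "(q * D (r * f) - r * (q * D f)) + (q * D (r * g) - r * (q * D g)) \<in> I"
          using I_add by blast
        then show "q * D (r * (f + g)) - r * (q * D (f + g)) \<in> I"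
          by (simp add: D_add algebra_simps)
      qed
    next
      case (mult s f)
      show ?case
      proof
        fix r assume r: "r \<in> carrier S"
        with mult have "q * D ((r * s) * f) - (r * s) * (q * D f) \<in> I"
          "r * (q * D (s * f) - s * (q * D f)) \<in> I"
          using I_mult by (simp_all only: poly_ring_closed(2) ball_simps)
        then have "(q * D ((r * s) * f) - (r * s) * (q * D f)) - r * (q * D (s * f) - s * (q * D f)) \<in> I"
          by (rule I_diff)
        then show "q * D (r * (s * f)) - r * (q * D (s * f)) \<in> I"
          by (simp add: algebra_simps)
      qed
    qed
    then show "q * D (r * f) - r * (q * D f) \<in> I" using r by auto
  qed (use q D_S I_carrier in \<open>auto simp: D_add distrib_left\<close>)
  then obtain d where d: "d \<in> derivations poly_consts S" "\<And>f. f \<in> I \<Longrightarrow> q * D f - d f \<in> I"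
    using rigid unfolding rigid_iff_hom_lift by blast
  have d_var: "d (poly_var k * poly_var l) = poly_var k * d (poly_var l) + poly_var l * d (poly_var k)"
    if "{k, l} \<in> E" for k l
    using d(1) edgeD[OF that] unfolding derivations_def by auto
  show thesis
  proof (rule that[of "\<lambda>k. d (poly_var k)"])
    show "d (poly_var k) \<in> carrier S" if "k \<in> {1..n}" for k
      using d(1) that poly_var_carrier[OF that] unfolding derivations_def by auto
    show "q - (poly_var i * d (poly_var j) + poly_var j * d (poly_var i)) \<in> I"
      using d(2)[OF edge_mem_I[OF ij]] D_ij[of 1] by (simp add: d_var[OF ij])
    show "poly_var k * d (poly_var l) + poly_var l * d (poly_var k) \<in> I"
      if "{k, l} \<in> E" "{k, l} \<noteq> {i, j}" for k l
      using I_diff[OF other[OF that, of 1] d(2)[OF edge_mem_I[OF that(1)]]]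
      by (simp add: d_var[OF that(1)])
  qed
qed

section \<open>Obstructions from independent sets\<close>

lemma keys_sum_unit_exp: "finite F \<Longrightarrow> keys (\<Sum>k\<in>F. unit_exp k) = F"
  by (induction F rule: finite_induct) (auto simp: keys_plus_nat)

text \<open>The hypothesis on neighbours makes x_i * x_j mapped to x^F, with all other generators
  mapped to 0, a homomorphism. No derivation induces it: x_i * g_j + x_j * g_i cannot contain x^F,
  since F avoids i and j.\<close>

lemma not_rigid_if_blocked_edge:
  assumes ij: "{i, j} \<in> E" and F: "F \<subseteq> {1..n} - {i, j}" "indep F"
    and nb: "\<And>k. k \<notin> {i, j} \<Longrightarrow> {i, k} \<in> E \<or> {j, k} \<in> E \<Longrightarrow> \<not> indep (insert k F)"
  shows "\<not> rigid K n E"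
proof
  assume rigid: "rigid K n E"
  define m where "m = (\<Sum>k\<in>F. unit_exp k)"
  define q :: "'k mpoly" where "q = Poly_Mapping.single m 1"
  have m: "keys m = F" unfolding m_def using F finite_subset by (intro keys_sum_unit_exp) blast
  have q: "q \<in> carrier S" using F m by (auto simp: q_def poly_ring_def)
  have "q * poly_var k \<in> I" if "k \<notin> {i, j}" "{i, k} \<in> E \<or> {j, k} \<in> E" for k
  proof -
    have eq: "q * poly_var k = Poly_Mapping.single (m + unit_exp k) 1"
      by (simp add: q_def monom_eq_var_times mult.commute)
    have "k \<in> {1..n}" using that edgeD(3) by blast
    then have "q * poly_var k \<in> carrier S"
      using q poly_var_carrier by (blast intro: poly_ring_closed)
    then show ?thesis
      using nb[OF that] unfolding mem_I_iff eq by (auto simp: lookup_single when_def keys_plus_nat m)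
  qed
  from rigid_edge_hom[OF rigid ij q this] obtain g where
    g: "q - (poly_var i * g j + poly_var j * g i) \<in> I" by metis
  have "lookup (q - (poly_var i * g j + poly_var j * g i)) m = 1"
    using F by (auto simp: lookup_minus lookup_add lookup_var_times m q_def)
  with g show False using F(2) m unfolding mem_I_iff by auto
qed

lemma indep_singleton: "indep {k}"
  unfolding indep_def
proof
  fix e assume "e \<in> E"
  then have "card e = 2" using graph by (simp add: simple_graph_def)
  then show "\<not> e \<subseteq> {k}" using card_mono[of "{k}" e] by auto
qed

lemma indep_insert:
  assumes "indep F" "\<And>l. l \<in> F \<Longrightarrow> {k, l} \<notin> E"
  shows "indep (insert k F)"
  unfolding indep_def
proof
  fix e assume e: "e \<in> E"
  then obtain a b where "e = {a, b}" "a \<noteq> b" using graph by (auto simp: simple_graph_def card_2_iff)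
  then show "\<not> e \<subseteq> insert k F"
    using assms e unfolding indep_def by (auto simp: insert_commute)
qed

text \<open>The coefficient of \<open>g i\<close> at \<open>m\<close> is forced to be that of \<open>H (x\<^sub>i * x\<^sub>k)\<close> at \<open>m * x\<^sub>k\<close> for every
  neighbour \<open>k\<close> of \<open>i\<close> for which \<open>m * x\<^sub>k\<close> has independent support.  Triangle-freeness makes these
  prescriptions agree, and \<open>free\<close> kills the coefficients of \<open>H (x\<^sub>i * x\<^sub>j)\<close> at monomials containing
  neither \<open>x\<^sub>i\<close> nor \<open>x\<^sub>j\<close>, which no derivation could produce.\<close>

lemma rigid_if_triangle_free:
  assumes tri: "\<And>i k l. {i, k} \<in> E \<Longrightarrow> {i, l} \<in> E \<Longrightarrow> {k, l} \<notin> E"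
    and free: "\<And>i j F. \<lbrakk>{i, j} \<in> E; indep F; i \<notin> F; j \<notin> F\<rbrakk> \<Longrightarrow>
      \<exists>k. k \<notin> {i, j} \<and> ({i, k} \<in> E \<or> {j, k} \<in> E) \<and> indep (insert k F)"
  shows "rigid K n E"
proof (rule rigidI)
  fix H assume H: "hom_lift H"
  define p where "p i j = H (poly_var i * poly_var j)" for i j
  have p_sym: "p i j = p j i" for i j by (simp add: p_def mult.commute)
  have p_S: "p i j \<in> carrier S" if "{i, j} \<in> E" for i j
    using H edge_mem_I[OF that] unfolding hom_lift_def p_def by blast
  \<comment> \<open>Modulo \<open>I\<close> both products represent the value of \<open>H\<close> at
    x_i * x_k * x_l.\<close>
  have swap: "lookup (poly_var l * p i k) m = lookup (poly_var k * p i l) m"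
    if "{i, k} \<in> E" "{i, l} \<in> E" "indep (keys m)" for i k l m
  proof -
    have *: "H (poly_var l * (poly_var i * poly_var k)) - poly_var l * p i k \<in> I"
      if "{i, k} \<in> E" "{i, l} \<in> E" for k l
      using H edge_mem_I[OF that(1)] edgeD(5)[OF that(2)] unfolding hom_lift_def p_def by blast
    from I_diff[OF *[OF that(1,2)] *[OF that(2,1)]]
    have "poly_var k * p i l - poly_var l * p i k \<in> I"
      by (simp add: mult_ac)
    then show ?thesis using that(3) by (simp add: mem_I_iff lookup_minus)
  qed
  \<comment> \<open>Without the edge kl the support stays independent after multiplying by both x_k
    and x_l, so \<open>swap\<close> can be read off at m * x_k * x_l.\<close>
  have agree: "lookup (p i k) (m + unit_exp k) = lookup (p i l) (m + unit_exp l)"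
    if ik: "{i, k} \<in> E" and il: "{i, l} \<in> E"
      and indep: "indep (insert k (keys m))" "indep (insert l (keys m))" for i k l m
  proof -
    have "indep (insert l (insert k (keys m)))"
      using indep tri[OF ik il] unfolding indep_def[of "insert l (keys m)"]
      by (intro indep_insert[of "insert k (keys m)"]) (auto simp: insert_commute)
    then have "indep (keys (m + unit_exp k + unit_exp l))"
      by (simp add: keys_plus_nat insert_commute)
    moreover have "m + unit_exp k + unit_exp l = m + unit_exp l + unit_exp k"
      by (simp add: ac_simps)
    ultimately show ?thesis
      using swap[OF ik il, of "m + unit_exp k + unit_exp l"] by (metis lookup_var_times')
  qed
  define ok where "ok i m k \<longleftrightarrow> {i, k} \<in> E \<and> indep (insert k (keys m))"
    for i k :: nat and m :: "nat \<Rightarrow>\<^sub>0 nat"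
  \<comment> \<open>The default 0 is harmless: if no \<open>k\<close> is admissible, every
    neighbour's variable times the monomial \<open>m\<close> has dependent support, so this
    coefficient is invisible modulo \<open>I\<close>.\<close>
  define c where "c i m =
      (if \<exists>k. ok i m k then let k = SOME k. ok i m k in lookup (p i k) (m + unit_exp k) else 0)"
    for i :: nat and m :: "nat \<Rightarrow>\<^sub>0 nat"
  have c: "c i m = lookup (p i k) (m + unit_exp k)" if "ok i m k" for i m k
  proof -
    define l where "l = (SOME k. ok i m k)"
    have "ok i m l" unfolding l_def using that by (rule someI)
    with that have "lookup (p i k) (m + unit_exp k) = lookup (p i l) (m + unit_exp l)"
      unfolding ok_def by (blast intro: agree)
    moreover have "c i m = lookup (p i l) (m + unit_exp l)"
      using that unfolding c_def l_def Let_def by auto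
    ultimately show ?thesis by simp
  qed
  have c_nz: "\<exists>k. {i, k} \<in> E \<and> lookup (divide_var k (p i k)) m \<noteq> 0" if "c i m \<noteq> 0" for i m
  proof -
    from that obtain k where "ok i m k" by (auto simp: c_def split: if_splits)
    with c that show ?thesis by (auto simp: ok_def lookup_divide_var)
  qed
  \<comment> \<open>Each nonzero value is a coefficient of one of finitely many polynomials, so
    \<open>c i\<close> defines a polynomial.\<close>
  have fin: "finite {m. c i m \<noteq> 0}" for i
  proof (rule finite_subset)
    show "{m. c i m \<noteq> 0} \<subseteq> (\<Union>k\<in>{1..n}. keys (divide_var k (p i k)))"
      using c_nz edgeD(3) by (fastforce simp: in_keys_iff)
  qed simp
  define g where "g i = Abs_poly_mapping (c i)" for i
  have g: "lookup (g i) = c i" for i unfolding g_def using fin by simp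
  have gS: "g i \<in> carrier S" for i
    unfolding carrier_poly_ring g
  proof (intro allI impI)
    fix m assume "c i m \<noteq> 0"
    from c_nz[OF this] obtain k
      where k: "{i, k} \<in> E" "lookup (divide_var k (p i k)) m \<noteq> 0" by blast
    then show "keys m \<subseteq> {1..n}"
      using divide_var_carrier[OF p_S[OF k(1)]] unfolding carrier_poly_ring by blast
  qed
  have "p i j - (poly_var i * g j + poly_var j * g i) \<in> I" if ij: "{i, j} \<in> E" for i j
    unfolding mem_I_iff
  proof (intro conjI allI impI)
    show "p i j - (poly_var i * g j + poly_var j * g i) \<in> carrier S"
      using p_S[OF ij] edgeD[OF ij] gS by simp
    fix m :: "nat \<Rightarrow>\<^sub>0 nat" assume m: "indep (keys m)"
    \<comment> \<open>Apply \<open>c\<close> to vertex \<open>j\<close> at m / x_i, with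
      \<open>i\<close> as the admissible neighbour.\<close>
    have val: "lookup (p i j) m = lookup (poly_var i * g j) m"
      if ij: "{i, j} \<in> E" and i: "i \<in> keys m" for i j
    proof -
      have "ok j (m - unit_exp i) i" unfolding ok_def
        using ij i m minus_plus_unit_exp[OF i] keys_plus_nat[of "m - unit_exp i" "unit_exp i"]
        by (simp add: insert_commute)
      from c[OF this] show ?thesis
        using i by (simp add: lookup_var_times g minus_plus_unit_exp p_sym[of i j])
    qed
    have "\<not> (i \<in> keys m \<and> j \<in> keys m)" using m ij unfolding indep_def by auto
    then consider "i \<in> keys m" "j \<notin> keys m" | "j \<in> keys m" "i \<notin> keys m"
      | "i \<notin> keys m" "j \<notin> keys m" by blast
    then show "lookup (p i j - (poly_var i * g j + poly_var j * g i)) m = 0"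
    proof cases
      case 1
      then show ?thesis
        using val[OF ij] by (simp add: lookup_minus lookup_add lookup_var_times[of j])
    next
      case 2
      then show ?thesis
        using val[of j i] ij p_sym[of i j]
        by (simp add: lookup_minus lookup_add lookup_var_times[of i] insert_commute)
    next
      case 3
      \<comment> \<open>Compare coefficients at m * x_k in \<open>swap\<close>: the left side gives
        that of \<open>p i j\<close> at \<open>m\<close>, while on the right x_j does not divide m *
        x_k.\<close>
      have zero: "lookup (p i j) m = 0"
        if ij: "{i, j} \<in> E" "j \<notin> keys m" and k: "k \<notin> {i, j}" "{i, k} \<in> E" "indep (insert k (keys m))"
        for i j k
        using swap[OF ij(1) k(2), of "m + unit_exp k"] that
        by (simp add: keys_plus_nat lookup_var_times[of j])
      from free[OF ij m 3] obtain k where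
        k: "k \<notin> {i, j}" "{i, k} \<in> E \<or> {j, k} \<in> E" "indep (insert k (keys m))" by blast
      then have "lookup (p i j) m = 0"
        using zero[of i j k] zero[of j i k] 3 ij p_sym[of i j] by (auto simp: insert_commute)
      with 3 show ?thesis by (simp add: lookup_minus lookup_add lookup_var_times)
    qed
  qed
  with gS show "\<exists>g. (\<forall>i\<in>{1..n}. g i \<in> carrier S) \<and>
    (\<forall>i j. {i, j} \<in> E \<longrightarrow>
       H (poly_var i * poly_var j) - (poly_var i * g j + poly_var j * g i) \<in> I)"
    unfolding p_def by blast
qed

text \<open>Test the homomorphism x_i * x_j to x_i, all other generators to 0. On the edge ij the
  coefficient of x_i forces g_j to have constant term 1; on the edge jk the coefficient of x_k
  forces it to be 0.\<close>

lemma not_rigid_if_dominated: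
  assumes ij: "{i, j} \<in> E" and jk: "{j, k} \<in> E" "k \<noteq> i"
    and dom: "\<And>l. {j, l} \<in> E \<Longrightarrow> l \<noteq> i \<Longrightarrow> {i, l} \<in> E"
  shows "\<not> rigid K n E"
proof
  assume rigid: "rigid K n E"
  have "poly_var i * poly_var l \<in> I" if "l \<notin> {i, j}" "{i, l} \<in> E \<or> {j, l} \<in> E" for l
    using that dom edge_mem_I by blast
  from rigid_edge_hom[OF rigid ij edgeD(4)[OF ij] this] obtain g where
    g: "poly_var i * 1 - (poly_var i * g j + poly_var j * g i) \<in> I"
      "poly_var j * g k + poly_var k * g j \<in> I"
    using jk edgeD(1)[OF jk(1)] by (metis doubleton_eq_iff mult_1_right)
  have "lookup (g j) 0 = 1"
    using g(1) edgeD(1)[OF ij] indep_singleton[of i] unfolding mem_I_iff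
    by (auto simp: lookup_minus lookup_add lookup_var_times simp del: mult_1_right
        dest!: spec[of _ "unit_exp i"])
  moreover have "lookup (g j) 0 = 0"
    using g(2) edgeD(1)[OF jk(1)] indep_singleton[of k] unfolding mem_I_iff
    by (auto simp: lookup_add lookup_var_times dest!: spec[of _ "unit_exp k"])
  ultimately show False by simp
qed

end

section \<open>Cycles\<close>

locale cycle_ideal = simple_graph_ideal +
  fixes v :: "nat \<Rightarrow> nat"
  assumes v: "bij_betw v {..<n} {1..n}" and n: "3 \<le> n"
    and E: "E = {{v i, v (Suc i mod n)} | i. i < n}"
begin

section \<open>Positions and adjacency on a cycle\<close>

definition succ :: "nat \<Rightarrow> nat" where
  "succ a = (if Suc a = n then 0 else Suc a)"

definition pred :: "nat \<Rightarrow> nat" where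
  "pred a = (if a = 0 then n - 1 else a - 1)"

lemma succ_pred_less [simp]: "a < n \<Longrightarrow> succ a < n" "a < n \<Longrightarrow> pred a < n"
  using n by (auto simp: succ_def pred_def)

lemma v_eq_iff [simp]: "a < n \<Longrightarrow> b < n \<Longrightarrow> v a = v b \<longleftrightarrow> a = b"
  using v by (auto simp: bij_betw_def inj_on_eq_iff)

text \<open>Trades reduction modulo n for a case distinction that simplification can
  evaluate.\<close>

lemma E_succ: "E = {{v a, v (succ a)} | a. a < n}"
proof -
  have "Suc a mod n = succ a" if "a < n" for a
    using that by (simp add: succ_def mod_Suc)
  then show ?thesis unfolding E by (intro Collect_cong ex_cong1) auto
qed

lemma edge_iff:
  assumes "a < n"
  shows "{v a, l} \<in> E \<longleftrightarrow> l = v (succ a) \<or> l = v (pred a)"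
proof
  assume "{v a, l} \<in> E"
  then obtain b where "b < n" "{v a, l} = {v b, v (succ b)}" unfolding E_succ by blast
  moreover have "pred (succ b) = b" if "b < n" for b using that by (auto simp: succ_def pred_def)
  ultimately show "l = v (succ a) \<or> l = v (pred a)"
    using assms by (auto simp: doubleton_eq_iff)
next
  have "succ (pred a) = a" using assms n by (auto simp: succ_def pred_def)
  then have "{v (pred a), v a} \<in> E" unfolding E_succ using assms
    by (metis (mono_tags, lifting) mem_Collect_eq succ_pred_less(2))
  moreover have "{v a, v (succ a)} \<in> E" unfolding E_succ using assms by blast
  ultimately show "{v a, l} \<in> E" if "l = v (succ a) \<or> l = v (pred a)"
    using that by (auto simp: insert_commute)
qed

lemma edge_obtain:
  assumes "{i, j} \<in> E"
  obtains a where "a < n" "i = v a"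
  using edgeD(2)[OF assms] v unfolding bij_betw_def by blast

text \<open>The neighbours of position a are a + 1 and a - 1; they are adjacent only if 2 is 1 or -1
  modulo n, which forces n = 3.\<close>

lemma triangle_free:
  assumes "n \<noteq> 3" and ik: "{i, k} \<in> E" and il: "{i, l} \<in> E"
  shows "{k, l} \<notin> E"
proof
  assume kl: "{k, l} \<in> E"
  obtain a where a: "a < n" "i = v a" using edge_obtain ik .
  have "k = v (succ a) \<or> k = v (pred a)" "l = v (succ a) \<or> l = v (pred a)" "k \<noteq> l"
    using ik il a edgeD(1)[OF kl] by (simp_all add: edge_iff)
  with kl have "{v (succ a), v (pred a)} \<in> E" by (metis insert_commute)
  with a have "pred a = succ (succ a) \<or> pred a = pred (succ a)" by (simp add: edge_iff)
  with a n \<open>n \<noteq> 3\<close> show False by (auto simp: succ_def pred_def split: if_splits)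
qed

text \<open>In a triangle the remaining neighbour of \<open>v 1\<close> is also adjacent to
  \<open>v 0\<close>, so domination applies.\<close>

lemma not_rigid_3:
  assumes "n = 3"
  shows "\<not> rigid K n E"
proof (rule not_rigid_if_dominated[of "v 0" "v 1" "v 2"])
  have less: "0 < n" "1 < n" "2 < n" using assms by auto
  have sp: "succ 0 = 1" "succ 1 = 2" "pred 0 = 2" "pred 1 = 0"
    unfolding succ_def pred_def using assms by simp_all
  show "{v 0, v 1} \<in> E" "{v 1, v 2} \<in> E"
    unfolding edge_iff[OF less(1)] edge_iff[OF less(2)] sp by simp_all
  show "v 2 \<noteq> v 0" using less by simp
  show "{v 0, l} \<in> E" if "{v 1, l} \<in> E" "l \<noteq> v 0" for l
    using that unfolding edge_iff[OF less(1)] edge_iff[OF less(2)] sp by simp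
qed

text \<open>The edge at positions 2 and 3 has outer neighbours at 1 and 4. Position 0 blocks the
  first and the successor of 4 blocks the second.\<close>

lemma not_rigid_5_or_ge_7:
  assumes "n = 5 \<or> n \<ge> 7"
  shows "\<not> rigid K n E"
proof -
  \<comment> \<open>This is the successor of 4; for n = 5 it wraps to 0 and the blocking set is a
    single vertex.\<close>
  define t where "t = (if n = 5 then 0 else 5 :: nat)"
  have sp: "succ 2 = 3" "pred 2 = 1" "succ 3 = 4" "pred 3 = 2" "succ (Suc 0) = 2" "pred (Suc 0) = 0"
    "succ 4 = t" "pred 4 = 3" using assms by (auto simp: succ_def pred_def t_def)
  \<comment> \<open>Nonadjacency to position 0 is where n = 6 would fail: there 5 is
    \<open>pred 0\<close>.\<close>
  have t: "t < n" "t \<noteq> 2" "t \<noteq> 3" "t \<noteq> succ 0" "t \<noteq> pred 0"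
    using assms by (auto simp: t_def succ_def pred_def)
  have less: "0 < n" "1 < n" "2 < n" "3 < n" "4 < n" using assms by auto
  have vI: "v a \<in> {1..n}" if "a < n" for a using v that by (auto simp: bij_betw_def)
  show ?thesis
  proof (rule not_rigid_if_blocked_edge[of "v 2" "v 3" "{v 0, v t}"])
    show "{v 2, v 3} \<in> E" using less by (simp add: edge_iff sp)
    show "{v 0, v t} \<subseteq> {1..n} - {v 2, v 3}" using t less vI by auto
    show "indep {v 0, v t}"
      using t less by (intro indep_insert indep_singleton) (auto simp: edge_iff)
    show "\<not> indep (insert k {v 0, v t})" if "k \<notin> {v 2, v 3}" "{v 2, k} \<in> E \<or> {v 3, k} \<in> E" for k
    proof -
      have "k = v 1 \<or> k = v 4" using that less by (auto simp: edge_iff sp)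
      then have "{v 1, v 0} \<subseteq> insert k {v 0, v t} \<or> {v 4, v t} \<subseteq> insert k {v 0, v t}" by auto
      moreover have "{v 1, v 0} \<in> E" "{v 4, v t} \<in> E" using less by (auto simp: edge_iff sp)
      ultimately show ?thesis unfolding indep_def by metis
    qed
  qed
qed

text \<open>To block the edge at a and a + 1, F would need the vertices at a - 2 and a + 3. These
  positions differ by 5, which is 1 modulo 4 and -1 modulo 6, so they are adjacent and cannot both
  lie in F.\<close>

lemma rigid_4_or_6:
  assumes "n = 4 \<or> n = 6"
  shows "rigid K n E"
proof (rule rigid_if_triangle_free)
  show "{k, l} \<notin> E" if "{i, k} \<in> E" "{i, l} \<in> E" for i k l
    using triangle_free[OF _ that] assms by auto
  have ex: "\<exists>k. k \<notin> {v a, v (succ a)} \<and> ({v a, k} \<in> E \<or> {v (succ a), k} \<in> E) \<and> indep (insert k F)"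
    if a: "a < n" and F: "indep F" "v a \<notin> F" "v (succ a) \<notin> F" for a F
  proof -
    let ?b = "succ (succ a)"
    let ?c = "succ ?b"
    have sp: "pred (succ a) = a" "pred ?b = succ a" "succ (pred a) = a"
      "pred a \<noteq> a" "pred a \<noteq> succ a" "?b \<noteq> a" "?b \<noteq> succ a"
      "pred (pred a) = succ ?c \<or> pred (pred a) = pred ?c"
      using a assms by (auto simp: succ_def pred_def split: if_splits)
    \<comment> \<open>The two potential blockers of the edge are adjacent, so \<open>F\<close> misses one of them.\<close>
    have "{v ?c, v (pred (pred a))} \<in> E" using a sp(8) by (auto simp: edge_iff)
    then have "\<not> {v ?c, v (pred (pred a))} \<subseteq> F" using F(1) unfolding indep_def by blast
    then consider "v (pred (pred a)) \<notin> F" | "v ?c \<notin> F" by blast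
    then show ?thesis
    proof cases
      case 1
      \<comment> \<open>The neighbours of \<open>v (pred a)\<close> are \<open>v a\<close> and
        \<open>v (pred (pred a))\<close>, both outside \<open>F\<close>; the other case is its
        mirror image.\<close>
      then have "indep (insert (v (pred a)) F)"
        using a F by (intro indep_insert) (auto simp: edge_iff sp)
      then show ?thesis using a sp by (intro exI[of _ "v (pred a)"]) (auto simp: edge_iff)
    next
      case 2
      then have "indep (insert (v ?b) F)"
        using a F by (intro indep_insert) (auto simp: edge_iff sp)
      then show ?thesis using a sp by (intro exI[of _ "v ?b"]) (auto simp: edge_iff)
    qed
  qed
  fix i j F assume ij: "{i, j} \<in> E" and F: "indep F" "i \<notin> F" "j \<notin> F"
  from ij obtain a where "a < n" "{i, j} = {v a, v (succ a)}" unfolding E_succ by blast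
  then show "\<exists>k. k \<notin> {i, j} \<and> ({i, k} \<in> E \<or> {j, k} \<in> E) \<and> indep (insert k F)"
    using ex[of a F] F by (auto simp: doubleton_eq_iff)
qed

end

theorem corollary3p13:
  fixes n :: nat and C :: "nat set set"
  assumes "3 \<le> n" and "cycle_graph n C"
  shows "rigid TYPE('k::field) n C \<longleftrightarrow> n = 4 \<or> n = 6"
proof -
  from assms obtain v where "simple_graph n C" "bij_betw v {..<n} {1..n}"
    "C = {{v i, v (Suc i mod n)} | i. i < n}"
    unfolding cycle_graph_def by blast
  with assms interpret cycle_ideal n C "TYPE('k)" v
    by unfold_locales
  have "n = 3 \<or> n = 4 \<or> n = 6 \<or> n = 5 \<or> n \<ge> 7" using assms(1) by linarith
  then show ?thesis using not_rigid_3 not_rigid_5_or_ge_7 rigid_4_or_6 by auto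
qed

end
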